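(* Let $K$ be a compact zerodimensional space supporting a strictly positive measure $\mu$ (i.e. $\mu(U)>0$ for every nonempty open $U\subseteq K$), and let $f\colon K\to 2^\omega$ be a finite-to-one continuous map (every fiber $f^{-1}[\{t\}]$ is finite). Then $K$ is separable.
   Context: A measure on a compact space means a Radon probability measure on its Borel sets. *)

theory Defs
  imports "HOL-Analysis.Analysis" "HOL-Probability.Probability_Measure"
begin

definition zerodimensional_space :: "'a topology \<Rightarrow> bool" where
  "zerodimensional_space X \<longleftrightarrow> neighbourhood_base_of (\<lambda>U. openin X U \<and> closedin X U) X"

lemma zerodimensional_space_iff_dim_le_0: "zerodimensional_space X \<longleftrightarrow> X dim_le 0"
  by (simp add: zerodimensional_space_def dimension_le_0_neighbourhood_base_of_clopen conj_commute)

definition borel_sigma_algebra_of :: "'a topology \<Rightarrow> 'a measure" where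
  "borel_sigma_algebra_of X = sigma (topspace X) {U. openin X U}"

text \<open>The condition \<open>C \<in> sets M\<close> is redundant when \<open>X\<close> is Hausdorff.\<close>

definition radon_probability_measure_on :: "'a topology \<Rightarrow> 'a measure \<Rightarrow> bool" where
  "radon_probability_measure_on X M \<longleftrightarrow>
     prob_space M \<and>
     sets M = sets (borel_sigma_algebra_of X) \<and>
     (\<forall>B\<in>sets M. emeasure M B = (SUP C\<in>{C. compactin X C \<and> C \<in> sets M \<and> C \<subseteq> B}. emeasure M C))"

definition strictly_positive_measure_on :: "'a topology \<Rightarrow> 'a measure \<Rightarrow> bool" where
  "strictly_positive_measure_on X M \<longleftrightarrow> (\<forall>U. openin X U \<and> U \<noteq> {} \<longrightarrow> 0 < emeasure M U)"

abbreviation cantor_space :: "(nat \<Rightarrow> bool) topology" where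
  "cantor_space \<equiv> product_topology (\<lambda>_. discrete_topology UNIV) UNIV"

end

theory Submission
  imports Defs
begin

text \<open>
  Some countable set \<open>D\<close> has a closure of maximal measure among the closures of countable sets, so
  countable sets with closure disjoint from that of \<open>D\<close> have null closure. If \<open>D\<close> is not dense,
  strict positivity and inner regularity give a compact \<open>C\<^sub>0\<close> of positive measure disjoint from
  the closure of \<open>D\<close>. Any compact \<open>C \<subseteq> C\<^sub>0\<close> contains the closure \<open>E\<close> of a countable set with
  \<open>f[E] = f[C]\<close> (lift a countable dense subset of \<open>f[C]\<close>). As \<open>E\<close> is null, \<open>C - E\<close> contains a
  compact set of positive measure whenever \<open>C\<close> has positive measure. Iterating yields decreasing
  compact sets \<open>C\<^sub>n\<close> and pairwise disjoint sets \<open>E\<^sub>n \<subseteq> C\<^sub>n\<close> with \<open>f[E\<^sub>n] = f[C\<^sub>n]\<close>; the fiber of \<open>f\<close>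
  through a point of \<open>\<Inter>n. C\<^sub>n\<close> meets every \<open>E\<^sub>n\<close> and is therefore infinite.
\<close>

lemma second_countable_euclidean:
  "second_countable (euclidean :: 'a::second_countable_topology topology)"
proof -
  obtain B :: "'a set set" where "countable B" "topological_basis B"
    using ex_countable_basis by blast
  then show ?thesis
    unfolding second_countable_def
    by (metis open_openin topological_basisE topological_basis_open)
qed

instance bool :: second_countable_topology
proof
  show "\<exists>B::bool set set. countable B \<and> open = generate_topology B"
    by (intro exI[of _ "range lessThan \<union> range greaterThan"]) (auto simp: open_bool_def)
qed

lemma second_countable_cantor_space: "second_countable cantor_space"
proof -
  have "(euclidean :: bool topology) = discrete_topology UNIV"
    by (simp add: topology_eq open_discrete flip: open_openin)
  then show ?thesis
    using second_countable_euclidean[where 'a = "nat \<Rightarrow> bool"]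
    by (simp flip: euclidean_product_topology)
qed

lemma closed_map_ex_countable_image_closure_of_eq:
  assumes f: "closed_map X Y f" and C: "closedin X C"
    and sep: "separable_space (subtopology Y (f ` C))"
  obtains D where "countable D" "D \<subseteq> C" "f ` (X closure_of D) = f ` C"
proof -
  have CX: "C \<subseteq> topspace X"
    using C by (rule closedin_subset)
  then have fC: "f ` C \<subseteq> topspace Y"
    using closed_map_imp_subset_topspace[OF f] by auto
  obtain T where T: "countable T" "T \<subseteq> f ` C" "f ` C \<subseteq> Y closure_of T"
    using sep fC unfolding separable_space_def
    by (metis closure_of_subtopology inf.absorb_iff2 inf.cobounded2 topspace_subtopology)
  obtain D where D: "countable D" "D \<subseteq> C" "T = f ` D"
    using T(1,2) countable_subset_image by metis
  have "f ` C \<subseteq> Y closure_of (f ` D)"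
    using T(3) D(3) by simp
  also have "\<dots> \<subseteq> f ` (X closure_of D)"
    using f D(2) CX by (auto simp: closed_map_closure_of_image)
  finally have "f ` C \<subseteq> f ` (X closure_of D)" .
  moreover have "X closure_of D \<subseteq> C"
    using D(2) C by (rule closure_of_minimal)
  ultimately have "f ` (X closure_of D) = f ` C"
    by blast
  with D(1,2) show ?thesis by (rule that)
qed

lemma openin_in_sets_borel_sigma_algebra_of:
  assumes "openin X U"
  shows "U \<in> sets (borel_sigma_algebra_of X)"
  unfolding borel_sigma_algebra_of_def
  using assms openin_subset by (intro in_measure_of) auto

lemma closedin_in_sets_borel_sigma_algebra_of:
  assumes "closedin X S"
  shows "S \<in> sets (borel_sigma_algebra_of X)"
proof -
  have "topspace X - (topspace X - S) \<in> sets (borel_sigma_algebra_of X)"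
    using assms by (intro sets.Diff openin_in_sets_borel_sigma_algebra_of) auto
  then show ?thesis
    using assms by (simp add: closedin_subset double_diff)
qed

lemma radon_probability_measure_on_ex_compactin:
  assumes "radon_probability_measure_on X M" "0 < emeasure M B"
  obtains C where "compactin X C" "C \<subseteq> B" "0 < emeasure M C"
proof -
  have "B \<in> sets M"
    using assms(2) by (intro emeasure_neq_0_sets) auto
  then have "0 < (SUP C\<in>{C. compactin X C \<and> C \<in> sets M \<and> C \<subseteq> B}. emeasure M C)"
    using assms by (simp add: radon_probability_measure_on_def)
  then show ?thesis
    using that by (auto simp: less_SUP_iff)
qed

lemma mono_on_ex_countable_subset_maximal:
  fixes g :: "'a set \<Rightarrow> ennreal"
  assumes "mono_on (Pow A) g"
  obtains D where "countable D" "D \<subseteq> A" "\<And>E. countable E \<Longrightarrow> E \<subseteq> A \<Longrightarrow> g E \<le> g D"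
proof -
  let ?\<A> = "{D. countable D \<and> D \<subseteq> A}"
  obtain m :: "nat \<Rightarrow> ennreal" where m: "range m \<subseteq> g ` ?\<A>" "Sup (g ` ?\<A>) = (SUP n. m n)"
    using ennreal_Sup_countable_SUP[of "g ` ?\<A>"] by blast
  from m(1) have "\<forall>n. \<exists>D\<in>?\<A>. m n = g D" by blast
  then obtain D where D: "\<And>n. D n \<in> ?\<A>" "\<And>n. m n = g (D n)" by metis
  show ?thesis
  proof
    show "countable (\<Union>n. D n)" "(\<Union>n. D n) \<subseteq> A"
      using D(1) by auto
    fix E assume "countable E" "E \<subseteq> A"
    then have "g E \<le> Sup (g ` ?\<A>)"
      by (intro SUP_upper) auto
    also have "\<dots> \<le> g (\<Union>n. D n)"
      unfolding m(2) D(2) using D(1) by (intro SUP_least mono_onD[OF assms]) auto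
    finally show "g E \<le> g (\<Union>n. D n)" .
  qed
qed

definition countable_closures_null :: "'a topology \<Rightarrow> 'a measure \<Rightarrow> 'a set \<Rightarrow> bool" where
  "countable_closures_null X M A \<longleftrightarrow>
     (\<forall>D. countable D \<and> D \<subseteq> A \<longrightarrow> X closure_of D \<in> null_sets M)"

lemma countable_closures_null_subset:
  "countable_closures_null X M A \<Longrightarrow> B \<subseteq> A \<Longrightarrow> countable_closures_null X M B"
  unfolding countable_closures_null_def by blast

lemma (in finite_measure) ex_countable_closures_null_if_disjoint_closure_of:
  assumes sets: "\<And>S. closedin X S \<Longrightarrow> S \<in> sets M"
  obtains D where "countable D" "D \<subseteq> topspace X"
    "\<And>C. closedin X C \<Longrightarrow> disjnt C (X closure_of D) \<Longrightarrow> countable_closures_null X M C"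
proof -
  have "mono_on (Pow (topspace X)) (\<lambda>D. emeasure M (X closure_of D))"
    by (intro mono_onI emeasure_mono closure_of_mono sets closedin_closure_of)
  then obtain D where D: "countable D" "D \<subseteq> topspace X"
    and maximal: "\<And>E. countable E \<Longrightarrow> E \<subseteq> topspace X \<Longrightarrow>
      emeasure M (X closure_of E) \<le> emeasure M (X closure_of D)"
    using mono_on_ex_countable_subset_maximal by blast
  have "countable_closures_null X M C" if C: "closedin X C" "disjnt C (X closure_of D)" for C
    unfolding countable_closures_null_def
  proof (intro allI impI, elim conjE)
    fix B assume B: "countable B" "B \<subseteq> C"
    have "X closure_of B \<subseteq> C"
      using B(2) C(1) by (rule closure_of_minimal)
    then have "emeasure M (X closure_of B) + emeasure M (X closure_of D)
        = emeasure M (X closure_of (B \<union> D))"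
      using C(2) by (subst plus_emeasure) (auto simp: sets disjnt_def)
    also have "\<dots> \<le> emeasure M (X closure_of D)"
      using B D closedin_subset[OF C(1)] by (intro maximal) auto
    finally have "emeasure M (X closure_of B) = 0"
      by (simp add: emeasure_eq_measure order_antisym flip: ennreal_plus)
    then show "X closure_of B \<in> null_sets M"
      by (simp add: null_setsI sets)
  qed
  with D show ?thesis
    by (rule that)
qed

lemma ex_compactin_countable_closures_null_if_not_separable_space:
  assumes X: "Hausdorff_space X" "\<not> separable_space X"
    and M: "radon_probability_measure_on X M" "strictly_positive_measure_on X M"
  obtains C where "compactin X C" "0 < emeasure M C" "countable_closures_null X M C"
proof -
  interpret prob_space M
    using M(1) by (simp add: radon_probability_measure_on_def)
  have "S \<in> sets M" if "closedin X S" for S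
    using that M(1) closedin_in_sets_borel_sigma_algebra_of
    by (simp add: radon_probability_measure_on_def)
  then obtain D where D: "countable D" "D \<subseteq> topspace X"
    and null: "\<And>C. closedin X C \<Longrightarrow> disjnt C (X closure_of D) \<Longrightarrow> countable_closures_null X M C"
    using ex_countable_closures_null_if_disjoint_closure_of by metis
  have "topspace X - X closure_of D \<noteq> {}"
    using X(2) D closure_of_subset_topspace[of X D] unfolding separable_space_def by blast
  then have "0 < emeasure M (topspace X - X closure_of D)"
    using M(2) by (simp add: strictly_positive_measure_on_def openin_diff)
  then obtain C where C: "compactin X C" "C \<subseteq> topspace X - X closure_of D" "0 < emeasure M C"
    by (rule radon_probability_measure_on_ex_compactin[OF M(1)])
  from C(2) have "disjnt C (X closure_of D)"
    by (auto simp: disjnt_def)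
  then have "countable_closures_null X M C"
    using C(1) X(1) by (intro null compactin_imp_closedin)
  with C(1,3) show ?thesis by (rule that)
qed

lemma infinite_fiber_of_disjoint_family_on:
  assumes E: "disjoint_family_on E I" "\<And>i. i \<in> I \<Longrightarrow> t \<in> f ` E i" and I: "infinite I"
  shows "infinite {x \<in> (\<Union>i\<in>I. E i). f x = t}"
proof -
  have "\<forall>i\<in>I. \<exists>y. y \<in> E i \<and> f y = t"
    using E(2) by blast
  then obtain x where x: "\<And>i. i \<in> I \<Longrightarrow> x i \<in> E i \<and> f (x i) = t"
    by metis
  have "inj_on x I"
    using x E(1) unfolding disjoint_family_on_def by (intro inj_onI) (metis IntI empty_iff)
  then have "infinite (x ` I)"
    using I by (simp add: finite_image_iff)
  moreover have "x ` I \<subseteq> {x \<in> (\<Union>i\<in>I. E i). f x = t}"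
    using x by blast
  ultimately show ?thesis
    using finite_subset by blast
qed

lemma infinite_fiber_of_nested_compactin:
  assumes X: "Hausdorff_space X"
    and C: "\<And>n. compactin X (C n)" "\<And>n. C n \<noteq> {}"
    and E: "\<And>n. E n \<subseteq> C n" "\<And>n. f ` E n = f ` C n" "\<And>n. C (Suc n) \<subseteq> C n - E n"
  obtains x where "x \<in> C 0" "infinite {y \<in> C 0. f y = f x}"
proof -
  have dec: "decseq C"
    using E(3) by (intro decseq_SucI) auto
  have "compact_space (subtopology X (C 0))"
    using C(1) compact_space_subtopology by blast
  moreover have "closedin (subtopology X (C 0)) (C n)" for n
    by (meson C(1) X closedin_subset_topspace compactin_imp_closedin dec decseqD le0)
  ultimately have "(\<Inter>n. C n) \<noteq> {}"
    using compact_space_imp_nest C(2) dec by metis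
  then obtain x where x: "\<And>n. x \<in> C n" by auto
  have "E m \<inter> E n = {}" if "m < n" for m n
    using E(1)[of n] E(3)[of m] decseqD[OF dec, of "Suc m" n] that by auto
  then have "disjoint_family E"
    unfolding disjoint_family_on_def by (metis Int_commute linorder_neqE_nat)
  moreover have "f x \<in> f ` E n" for n
    using x E(2) by auto
  ultimately have "infinite {y \<in> (\<Union>n. E n). f y = f x}"
    by (intro infinite_fiber_of_disjoint_family_on) auto
  moreover have "(\<Union>n. E n) \<subseteq> C 0"
    using E(1) decseqD[OF dec, of 0] by blast
  ultimately have "infinite {y \<in> C 0. f y = f x}"
    by (auto elim!: infinite_super[rotated])
  with x show ?thesis by (rule that)
qed

lemma ex_compactin_avoiding_subset_of_same_image:
  assumes X: "Hausdorff_space X" and Y: "second_countable Y" and f: "closed_map X Y f"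
    and M: "radon_probability_measure_on X M"
    and C: "compactin X C" "0 < emeasure M C" "countable_closures_null X M C"
  obtains C' E where "compactin X C'" "0 < emeasure M C'" "E \<subseteq> C" "f ` E = f ` C" "C' \<subseteq> C - E"
proof -
  have closed: "closedin X C"
    using X C(1) by (rule compactin_imp_closedin)
  have "separable_space (subtopology Y (f ` C))"
    using Y by (intro second_countable_imp_separable_space second_countable_subtopology)
  then obtain D where D: "countable D" "D \<subseteq> C" "f ` (X closure_of D) = f ` C"
    using closed_map_ex_countable_image_closure_of_eq[OF f closed] by metis
  have "X closure_of D \<in> null_sets M"
    using C(3) D(1,2) by (simp add: countable_closures_null_def)
  moreover have "C \<in> sets M"
    using C(2) by (intro emeasure_neq_0_sets) auto
  ultimately have "emeasure M (C - X closure_of D) = emeasure M C"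
    by (rule emeasure_Diff_null_set)
  then obtain C' where C': "compactin X C'" "C' \<subseteq> C - X closure_of D" "0 < emeasure M C'"
    using C(2) radon_probability_measure_on_ex_compactin[OF M] by metis
  have "X closure_of D \<subseteq> C"
    using D(2) closed by (rule closure_of_minimal)
  with C' D(3) show ?thesis
    by (intro that)
qed

lemma infinite_fiber_if_countable_closures_null:
  assumes X: "Hausdorff_space X" and Y: "second_countable Y" and f: "closed_map X Y f"
    and M: "radon_probability_measure_on X M"
    and C: "compactin X C" "0 < emeasure M C" "countable_closures_null X M C"
  obtains x where "x \<in> C" "infinite {y \<in> C. f y = f x}"
proof -
  define positive where "positive A \<longleftrightarrow> compactin X A \<and> 0 < emeasure M A \<and> A \<subseteq> C" for A
  have "\<exists>A. \<forall>n. positive (A n) \<and> (\<exists>E\<subseteq>A n. f ` E = f ` A n \<and> A (Suc n) \<subseteq> A n - E)"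
  proof (rule dependent_nat_choice)
    show "\<exists>A. positive A"
      using C positive_def by blast
  next
    fix A :: "'a set" and n :: nat
    assume "positive A"
    then have A: "compactin X A" "0 < emeasure M A" "A \<subseteq> C"
      by (auto simp: positive_def)
    have "countable_closures_null X M A"
      using C(3) A(3) by (rule countable_closures_null_subset)
    then obtain A' E
      where A': "compactin X A'" "0 < emeasure M A'" "A' \<subseteq> A - E" and "E \<subseteq> A" "f ` E = f ` A"
      using ex_compactin_avoiding_subset_of_same_image[OF X Y f M A(1,2)] by metis
    moreover have "positive A'"
      using A' A(3) by (auto simp: positive_def)
    ultimately show "\<exists>A'. positive A' \<and> (\<exists>E\<subseteq>A. f ` E = f ` A \<and> A' \<subseteq> A - E)"
      by blast
  qed
  then obtain A E where A: "\<And>n. positive (A n)"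
    and E: "\<And>n. E n \<subseteq> A n" "\<And>n. f ` E n = f ` A n" "\<And>n. A (Suc n) \<subseteq> A n - E n"
    by metis
  have "compactin X (A n)" "A n \<noteq> {}" for n
    using A[of n] by (auto simp: positive_def)
  then obtain x where x: "x \<in> A 0" "infinite {y \<in> A 0. f y = f x}"
    using infinite_fiber_of_nested_compactin[where C = A and E = E, OF X _ _ E] by blast
  have "A 0 \<subseteq> C"
    using A by (simp add: positive_def)
  then have "x \<in> C" "{y \<in> A 0. f y = f x} \<subseteq> {y \<in> C. f y = f x}"
    using x(1) by auto
  with x(2) show ?thesis
    by (intro that) (auto dest: infinite_super)
qed

theorem separable_space_if_finite_to_one_closed_map:
  assumes X: "Hausdorff_space X" and Y: "second_countable Y"
    and M: "radon_probability_measure_on X M" "strictly_positive_measure_on X M"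
    and f: "closed_map X Y f"
    and fin: "\<And>t. t \<in> topspace Y \<Longrightarrow> finite {x \<in> topspace X. f x = t}"
  shows "separable_space X"
proof (rule ccontr)
  assume "\<not> separable_space X"
  then obtain C where C: "compactin X C" "0 < emeasure M C" "countable_closures_null X M C"
    using ex_compactin_countable_closures_null_if_not_separable_space[OF X _ M] by blast
  then obtain x where x: "x \<in> C" "infinite {y \<in> C. f y = f x}"
    by (rule infinite_fiber_if_countable_closures_null[OF X Y f M(1)])
  have "C \<subseteq> topspace X"
    using C(1) by (rule compactin_subset_topspace)
  then have "{y \<in> C. f y = f x} \<subseteq> {y \<in> topspace X. f y = f x}" "f x \<in> topspace Y"
    using x(1) closed_map_imp_subset_topspace[OF f] by auto
  with fin x(2) show False
    using finite_subset by blast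
qed

theorem theorem3p4:
  fixes K :: "'a topology" and \<mu> :: "'a measure" and f :: "'a \<Rightarrow> (nat \<Rightarrow> bool)"
  assumes "compact_space K" and "Hausdorff_space K" and "zerodimensional_space K"
    and "radon_probability_measure_on K \<mu>"
    and "strictly_positive_measure_on K \<mu>"
    and "continuous_map K cantor_space f"
    and "\<And>t. t \<in> topspace cantor_space \<Longrightarrow> finite {x \<in> topspace K. f x = t}"
  shows "separable_space K"
proof -
  have "Hausdorff_space cantor_space"
    by (simp add: Hausdorff_space_product_topology)
  with assms(1,6) have "closed_map K cantor_space f"
    using continuous_imp_closed_map by blast
  then show ?thesis
    by (rule separable_space_if_finite_to_one_closed_map
        [OF assms(2) second_countable_cantor_space assms(4,5) _ assms(7)])
qed

end
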